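(* Let $z\in[0,1]$ be a non-porosity point. Let $\mathcal P\subseteq[0,1]$ be a $\Pi^0_1$ class with $z\in\mathcal P$ and $\varrho(\mathcal P\mid z)<1$. Then $\varrho_2(\mathcal P\mid z)<1$.
   Context: $\lambda$ is Lebesgue measure. The lower density of $\mathcal C\subseteq\mathbb R$ at $z$ is $\varrho(\mathcal C\mid z)=\liminf_{\gamma,\delta\to0^+}\frac{\lambda([z-\gamma,z+\delta]\cap\mathcal C)}{\gamma+\delta}$. A basic dyadic interval is $[r2^{-n},(r+1)2^{-n}]$ with $r\in\mathbb Z,n\in\mathbb N$; the lower dyadic density is $\varrho_2(\mathcal C\mid z)=\liminf\frac{\lambda(I\cap\mathcal C)}{|I|}$, where $I$ ranges over basic dyadic intervals containing $z$ with $|I|\to0$. A set $\mathcal C\subseteq\mathbb R$ is porous at $z$ if there is $\varepsilon>0$ such that for arbitrarily small $\beta>0$ the interval $(z-\beta,z+\beta)$ contains an open interval of length $\varepsilon\beta$ disjoint from $\mathcal C$. $z$ is a porosity point if some effectively closed ($\Pi^0_1$) class containing $z$ is porous at $z$; otherwise $z$ is a non-porosity point. *)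

theory Defs
  imports "HOL-Analysis.Analysis" "HOL-Library.Nat_Bijection"
begin

text \<open>
  Neither computably enumerable sets nor effectively closed classes exist in the library.
  Computability is introduced through Kleene's partial recursive functions, given by terms
  and a big-step evaluation relation. There is no arity discipline: a term denotes one
  partial function on argument lists of each length, and each of these is partial recursive
  in the usual sense.
\<close>

datatype recf =
    Zero
  | Succ
  | Proj nat
  | Comp recf "recf list"
  | PrimRec recf recf
  | Mu recf

text \<open>\<open>rec_eval f xs y\<close>: the computation of \<open>f\<close> on \<open>xs\<close> converges with value \<open>y\<close>.\<close>

inductive rec_eval :: "recf \<Rightarrow> nat list \<Rightarrow> nat \<Rightarrow> bool" where
  Zero: "rec_eval Zero xs 0"
| Succ: "rec_eval Succ [x] (Suc x)"
| Proj: "i < length xs \<Longrightarrow> rec_eval (Proj i) xs (xs ! i)"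
| Comp: "list_all2 (\<lambda>g y. rec_eval g xs y) gs ys \<Longrightarrow> rec_eval f ys z \<Longrightarrow>
    rec_eval (Comp f gs) xs z"
| PrimRec_0: "rec_eval f xs y \<Longrightarrow> rec_eval (PrimRec f g) (0 # xs) y"
| PrimRec_Suc: "rec_eval (PrimRec f g) (n # xs) r \<Longrightarrow> rec_eval g (r # n # xs) y \<Longrightarrow>
    rec_eval (PrimRec f g) (Suc n # xs) y"
| Mu: "rec_eval f (n # xs) 0 \<Longrightarrow> (\<forall>m<n. \<exists>r. rec_eval f (m # xs) (Suc r)) \<Longrightarrow>
    rec_eval (Mu f) xs n"

definition computably_enumerable :: "nat set \<Rightarrow> bool" where
  "computably_enumerable W \<longleftrightarrow> (\<exists>f. W = {n. \<exists>y. rec_eval f [n] y})"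

text \<open>
  Effective numbering of the open intervals with rational endpoints. Two rationals always
  have a common denominator \<open>c + 1\<close>, so every such interval has an index; indices of
  degenerate pairs denote the empty set.
\<close>

definition rational_interval :: "nat \<Rightarrow> real set" where
  "rational_interval n =
     (let (k, c) = prod_decode n; (a, b) = prod_decode k
      in {real_of_int (int_decode a) / (real c + 1) <..< real_of_int (int_decode b) / (real c + 1)})"

definition effectively_open :: "real set \<Rightarrow> bool" where
  "effectively_open U \<longleftrightarrow>
     (\<exists>W. computably_enumerable W \<and> U = (\<Union>n\<in>W. rational_interval n))"

definition Pi01_class :: "real set \<Rightarrow> bool" where
  "Pi01_class P \<longleftrightarrow> effectively_open (- P)"

definition lower_density :: "real set \<Rightarrow> real \<Rightarrow> ereal" where
  "lower_density C z =
     Liminf (at_right 0 \<times>\<^sub>F at_right 0)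
       (\<lambda>(\<gamma>, \<delta>). ereal (measure lebesgue ({z - \<gamma>..z + \<delta>} \<inter> C) / (\<gamma> + \<delta>)))"

definition basic_dyadic_interval :: "real set \<Rightarrow> bool" where
  "basic_dyadic_interval I \<longleftrightarrow>
     (\<exists>(r::int) (n::nat). I = {real_of_int r / 2 ^ n .. (real_of_int r + 1) / 2 ^ n})"

text \<open>
  The filter on sets of reals generated by the families of all basic dyadic intervals
  containing \<open>z\<close> of length below a given positive bound.
\<close>

definition dyadic_filter :: "real \<Rightarrow> real set filter" where
  "dyadic_filter z =
     inf (filtercomap (measure lebesgue) (at_right 0))
       (principal {I. basic_dyadic_interval I \<and> z \<in> I})"

definition lower_dyadic_density :: "real set \<Rightarrow> real \<Rightarrow> ereal" where
  "lower_dyadic_density C z =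
     Liminf (dyadic_filter z)
       (\<lambda>I. ereal (measure lebesgue (I \<inter> C) / measure lebesgue I))"

definition porous_at :: "real set \<Rightarrow> real \<Rightarrow> bool" where
  "porous_at C z \<longleftrightarrow>
     (\<exists>\<epsilon>>0. \<exists>\<^sub>F \<beta> in at_right 0.
        \<exists>a. {a<..<a + \<epsilon> * \<beta>} \<subseteq> {z - \<beta><..<z + \<beta>} \<and> {a<..<a + \<epsilon> * \<beta>} \<inter> C = {})"

definition porosity_point :: "real \<Rightarrow> bool" where
  "porosity_point z \<longleftrightarrow> (\<exists>C. Pi01_class C \<and> z \<in> C \<and> porous_at C z)"

end

theory Submission imports Defs begin

text \<open>
  Suppose that the lower dyadic density of \<open>P\<close> at \<open>z\<close> is 1, while \<open>P\<close> has density at most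
  \<open>q < 1\<close> in arbitrarily short intervals around \<open>z\<close>. Let \<open>K > 2 / (1 - q)\<close> and let \<open>C\<close> be the
  complement of the union of the interiors of all sufficiently short dyadic intervals in which
  the open complement of \<open>P\<close> has relative measure above \<open>1 / K\<close>. No such interval contains \<open>z\<close>,
  so \<open>z \<in> C\<close>. An interval \<open>[z - \<gamma>, z + \<delta>]\<close> in which \<open>P\<close> is sparse is covered by boundedly many
  dyadic intervals of length about \<open>(\<gamma> + \<delta>) / 2\<close>, and by averaging one of them was removed.
  Hence \<open>C\<close> is porous at \<open>z\<close>.

  The class \<open>C\<close> is effectively closed because the density of an effectively open set in a dyadic
  interval is witnessed by finite data: a subdivision of the interval into equal cells, together
  with an enumerated rational interval for each cell, such that enough cells are contained in
  their rational intervals.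
\<close>

section \<open>Closure properties of computable functions and semidecidable relations\<close>

inductive_simps rec_eval_Zero_iff: "rec_eval Zero xs y"
inductive_simps rec_eval_Succ_iff: "rec_eval Succ xs y"
inductive_simps rec_eval_Proj_iff: "rec_eval (Proj i) xs y"
inductive_simps rec_eval_Comp_iff: "rec_eval (Comp f gs) xs y"
inductive_simps rec_eval_PrimRec_0_iff: "rec_eval (PrimRec f g) (0 # xs) y"
inductive_simps rec_eval_PrimRec_Suc_iff: "rec_eval (PrimRec f g) (Suc n # xs) y"
inductive_simps rec_eval_Mu_iff: "rec_eval (Mu f) xs y"

text \<open>The equivalence packs convergence and uniqueness of the value together, so
  single-valuedness travels along with the closure rules. The length is fixed because one term may
  denote different functions on lists of different lengths.\<close>

definition total_recursive :: "nat \<Rightarrow> (nat list \<Rightarrow> nat) \<Rightarrow> bool" where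
  "total_recursive k F \<longleftrightarrow>
     (\<exists>f. \<forall>xs. length xs = k \<longrightarrow> (\<forall>y. rec_eval f xs y \<longleftrightarrow> y = F xs))"

definition semidecidable :: "nat \<Rightarrow> (nat list \<Rightarrow> bool) \<Rightarrow> bool" where
  "semidecidable k R \<longleftrightarrow>
     (\<exists>f. \<forall>xs. length xs = k \<longrightarrow> ((\<exists>y. rec_eval f xs y) \<longleftrightarrow> R xs))"

section \<open>Composition and projections\<close>

lemma total_recursive_cong:
  assumes "total_recursive k F" "\<And>xs. length xs = k \<Longrightarrow> F xs = G xs"
  shows "total_recursive k G"
  using assms unfolding total_recursive_def by metis

lemma list_all2_rec_eval_map:
  assumes "\<And>G. G \<in> set Gs \<Longrightarrow> \<forall>y. rec_eval (c G) xs y \<longleftrightarrow> y = G xs"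
  shows "list_all2 (\<lambda>g y. rec_eval g xs y) (map c Gs) ys \<longleftrightarrow> ys = map (\<lambda>G. G xs) Gs"
  using assms
proof (induction Gs arbitrary: ys)
  case (Cons G Gs)
  then show ?case by (cases ys) auto
qed simp

text \<open>The inner programs are chosen before the outer one, so the same choice serves total
  functions and mere domains of convergence.\<close>

lemma rec_eval_Comp_total:
  assumes "\<And>G. G \<in> set Gs \<Longrightarrow> total_recursive k G"
  obtains gs where "\<And>f xs y. length xs = k \<Longrightarrow>
    rec_eval (Comp f gs) xs y \<longleftrightarrow> rec_eval f (map (\<lambda>G. G xs) Gs) y"
proof -
  have "\<forall>G\<in>set Gs. \<exists>g. \<forall>xs. length xs = k \<longrightarrow> (\<forall>y. rec_eval g xs y \<longleftrightarrow> y = G xs)"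
    using assms unfolding total_recursive_def by blast
  then obtain c where c: "\<forall>G\<in>set Gs. \<forall>xs. length xs = k \<longrightarrow> (\<forall>y. rec_eval (c G) xs y \<longleftrightarrow> y = G xs)"
    by metis
  show thesis
  proof (rule that[of "map c Gs"])
    fix f xs y
    assume "length (xs :: nat list) = k"
    then have "list_all2 (\<lambda>g y. rec_eval g xs y) (map c Gs) ys \<longleftrightarrow> ys = map (\<lambda>G. G xs) Gs" for ys
      using c by (intro list_all2_rec_eval_map) auto
    then show "rec_eval (Comp f (map c Gs)) xs y \<longleftrightarrow> rec_eval f (map (\<lambda>G. G xs) Gs) y"
      by (auto simp: rec_eval_Comp_iff)
  qed
qed

lemma total_recursive_compose:
  assumes "total_recursive (length Gs) F" "\<And>G. G \<in> set Gs \<Longrightarrow> total_recursive k G"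
  shows "total_recursive k (\<lambda>xs. F (map (\<lambda>G. G xs) Gs))"
proof -
  obtain gs where gs: "\<And>f xs y. length xs = k \<Longrightarrow>
    rec_eval (Comp f gs) xs y \<longleftrightarrow> rec_eval f (map (\<lambda>G. G xs) Gs) y"
    using rec_eval_Comp_total[of Gs k] assms(2) by blast
  obtain f where f: "\<And>xs y. length xs = length Gs \<Longrightarrow> rec_eval f xs y \<longleftrightarrow> y = F xs"
    using assms(1) unfolding total_recursive_def by blast
  show ?thesis
    unfolding total_recursive_def by (rule exI[of _ "Comp f gs"]) (simp add: gs f)
qed

lemma semidecidable_compose:
  assumes "semidecidable (length Gs) R" "\<And>G. G \<in> set Gs \<Longrightarrow> total_recursive k G"
  shows "semidecidable k (\<lambda>xs. R (map (\<lambda>G. G xs) Gs))"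
proof -
  obtain gs where gs: "\<And>f xs y. length xs = k \<Longrightarrow>
    rec_eval (Comp f gs) xs y \<longleftrightarrow> rec_eval f (map (\<lambda>G. G xs) Gs) y"
    using rec_eval_Comp_total[of Gs k] assms(2) by blast
  obtain f where f: "\<And>xs. length xs = length Gs \<Longrightarrow> (\<exists>y. rec_eval f xs y) \<longleftrightarrow> R xs"
    using assms(1) unfolding semidecidable_def by blast
  show ?thesis
    unfolding semidecidable_def
  proof (intro exI[of _ "Comp f gs"] allI impI)
    fix xs :: "nat list"
    assume "length xs = k"
    then show "(\<exists>y. rec_eval (Comp f gs) xs y) \<longleftrightarrow> R (map (\<lambda>G. G xs) Gs)"
      using gs f[of "map (\<lambda>G. G xs) Gs"] by simp
  qed
qed

lemma total_recursive_nth: "i < k \<Longrightarrow> total_recursive k (\<lambda>xs. xs ! i)"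
  unfolding total_recursive_def by (rule exI[of _ "Proj i"]) (auto simp: rec_eval_Proj_iff)

text \<open>The step function of a primitive recursion reads its arguments through \<open>hd\<close>
  and \<open>tl\<close>. This lemma and the next three are projections in that shape.\<close>

lemma total_recursive_hd: "0 < k \<Longrightarrow> total_recursive k hd"
  by (rule total_recursive_cong[OF total_recursive_nth[of 0]]) (auto simp: hd_conv_nth)

lemma total_recursive_hd_tl: "1 < k \<Longrightarrow> total_recursive k (\<lambda>xs. hd (tl xs))"
  by (rule total_recursive_cong[OF total_recursive_nth[of 1]])
     (auto simp: hd_conv_nth nth_tl simp flip: length_greater_0_conv)

lemma total_recursive_nth_tl: "Suc i < k \<Longrightarrow> total_recursive k (\<lambda>xs. tl xs ! i)"
  by (rule total_recursive_cong[OF total_recursive_nth[of "Suc i"]]) (auto simp: nth_tl)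

lemma total_recursive_nth_tl_tl:
  "Suc (Suc i) < k \<Longrightarrow> total_recursive k (\<lambda>xs. tl (tl xs) ! i)"
  by (rule total_recursive_cong[OF total_recursive_nth[of "Suc (Suc i)"]]) (auto simp: nth_tl)

lemma total_recursive_compose1:
  assumes "total_recursive 1 (\<lambda>xs. f (xs ! 0))" "total_recursive k F"
  shows "total_recursive k (\<lambda>xs. f (F xs))"
  using total_recursive_compose[of "[F]" "\<lambda>xs. f (xs ! 0)" k] assms by simp

lemma total_recursive_Suc:
  assumes "total_recursive k F"
  shows "total_recursive k (\<lambda>xs. Suc (F xs))"
proof (rule total_recursive_compose1[OF _ assms])
  have "length xs = 1 \<Longrightarrow> rec_eval Succ xs y \<longleftrightarrow> y = Suc (xs ! 0)" for xs y
    by (cases xs) (auto simp: rec_eval_Succ_iff)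
  then show "total_recursive 1 (\<lambda>xs. Suc (xs ! 0))"
    unfolding total_recursive_def by blast
qed

lemma total_recursive_const: "total_recursive k (\<lambda>xs. c)"
proof (induction c)
  case 0
  show ?case
    unfolding total_recursive_def by (rule exI[of _ Zero]) (simp add: rec_eval_Zero_iff)
qed (rule total_recursive_Suc)

section \<open>Primitive recursion, arithmetic and decidable comparisons\<close>

lemma total_recursive_PrimRec:
  assumes "total_recursive k A" "total_recursive (Suc (Suc k)) B"
  shows "total_recursive (Suc k) (\<lambda>ys. rec_nat (A (tl ys)) (\<lambda>n r. B (r # n # tl ys)) (hd ys))"
proof -
  obtain a where a: "\<And>xs y. length xs = k \<Longrightarrow> rec_eval a xs y \<longleftrightarrow> y = A xs"
    using assms(1) unfolding total_recursive_def by blast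
  obtain b where b: "\<And>xs y. length xs = Suc (Suc k) \<Longrightarrow> rec_eval b xs y \<longleftrightarrow> y = B xs"
    using assms(2) unfolding total_recursive_def by blast
  have *: "rec_eval (PrimRec a b) (N # xs) y \<longleftrightarrow> y = rec_nat (A xs) (\<lambda>n r. B (r # n # xs)) N"
    if "length xs = k" for N xs y
    by (induction N arbitrary: y)
       (auto simp: rec_eval_PrimRec_0_iff rec_eval_PrimRec_Suc_iff a b that)
  have "rec_eval (PrimRec a b) ys y \<longleftrightarrow>
      y = rec_nat (A (tl ys)) (\<lambda>n r. B (r # n # tl ys)) (hd ys)"
    if "length ys = Suc k" for ys y
    using that * by (cases ys) auto
  then show ?thesis
    unfolding total_recursive_def by blast
qed

lemma map_nth_upt_length: "length xs = k \<Longrightarrow> map ((!) xs) [0..<k] = xs"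
  using map_nth by blast

text \<open>\<open>PrimRec\<close> recurses on the head of its list. Composing with \<open>N\<close>
  followed by all \<open>k\<close> projections moves a computed bound into that position and keeps
  the parameters.\<close>

lemma total_recursive_rec_nat:
  assumes "total_recursive k A" "total_recursive k N"
    and B: "total_recursive (Suc (Suc k)) (\<lambda>ys. B (hd ys) (hd (tl ys)) (tl (tl ys)))"
  shows "total_recursive k (\<lambda>xs. rec_nat (A xs) (\<lambda>n r. B r n xs) (N xs))"
proof -
  have "total_recursive k (\<lambda>xs. (\<lambda>ys. rec_nat (A (tl ys)) (\<lambda>n r. B r n (tl ys)) (hd ys))
      (map (\<lambda>G. G xs) (N # map (\<lambda>i xs. xs ! i) [0..<k])))"
    using total_recursive_PrimRec[OF assms(1) B] assms(2)
    by (intro total_recursive_compose) (auto intro: total_recursive_nth)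
  then show ?thesis
    by (rule total_recursive_cong) (simp add: comp_def map_nth_upt_length)
qed

lemma total_recursive_pred:
  assumes "total_recursive k F"
  shows "total_recursive k (\<lambda>xs. F xs - 1)"
proof -
  have "total_recursive k (\<lambda>xs. rec_nat 0 (\<lambda>n r. n) (F xs))"
    by (intro total_recursive_rec_nat total_recursive_const assms total_recursive_hd_tl) simp
  moreover have "rec_nat 0 (\<lambda>n r. n) m = m - 1" for m :: nat
    by (cases m) auto
  ultimately show ?thesis by simp
qed

lemma total_recursive_add:
  assumes "total_recursive k F" "total_recursive k G"
  shows "total_recursive k (\<lambda>xs. F xs + G xs)"
proof -
  have "total_recursive k (\<lambda>xs. rec_nat (F xs) (\<lambda>n r. Suc r) (G xs))"
    by (intro total_recursive_rec_nat assms total_recursive_Suc total_recursive_hd) simp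
  moreover have "rec_nat a (\<lambda>n r. Suc r) b = a + b" for a b
    by (induction b) auto
  ultimately show ?thesis by simp
qed

lemma total_recursive_diff:
  assumes "total_recursive k F" "total_recursive k G"
  shows "total_recursive k (\<lambda>xs. F xs - G xs)"
proof -
  have "total_recursive k (\<lambda>xs. rec_nat (F xs) (\<lambda>n r. r - 1) (G xs))"
    by (intro total_recursive_rec_nat assms total_recursive_pred total_recursive_hd) simp
  moreover have "rec_nat a (\<lambda>n r. r - 1) b = a - b" for a b :: nat
    by (induction b) auto
  ultimately show ?thesis by simp
qed

lemma total_recursive_sum:
  assumes "total_recursive k N" "total_recursive (Suc k) (\<lambda>ys. G (hd ys) (tl ys))"
  shows "total_recursive k (\<lambda>xs. \<Sum>j<N xs. G j xs)"
proof -
  \<comment> \<open>The projections shifted by one drop the running value, on which the summand does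
    not depend.\<close>
  have "total_recursive (Suc (Suc k))
      (\<lambda>ys. (\<lambda>ys. G (hd ys) (tl ys)) (map (\<lambda>H. H ys) (map (\<lambda>i xs. xs ! Suc i) [0..<Suc k])))"
    using assms(2) by (intro total_recursive_compose) (auto intro: total_recursive_nth simp del: upt_Suc)
  then have "total_recursive (Suc (Suc k)) (\<lambda>ys. G (hd (tl ys)) (tl (tl ys)))"
  proof (rule total_recursive_cong)
    fix ys :: "nat list"
    assume ys: "length ys = Suc (Suc k)"
    have "map (\<lambda>i. ys ! Suc i) [0..<Suc k] = tl ys"
      using ys by (intro nth_equalityI) (auto simp: nth_tl simp del: upt_Suc)
    then show "(\<lambda>ys. G (hd ys) (tl ys)) (map (\<lambda>H. H ys) (map (\<lambda>i xs. xs ! Suc i) [0..<Suc k]))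
        = G (hd (tl ys)) (tl (tl ys))"
      by (simp add: comp_def del: upt_Suc)
  qed
  then have "total_recursive k (\<lambda>xs. rec_nat 0 (\<lambda>n r. r + G n xs) (N xs))"
    by (intro total_recursive_rec_nat total_recursive_const assms total_recursive_add
        total_recursive_hd) simp
  moreover have "rec_nat 0 (\<lambda>n r. r + G n xs) m = (\<Sum>j<m. G j xs)" for m xs
    by (induction m) auto
  ultimately show ?thesis by simp
qed

lemma total_recursive_mult:
  assumes "total_recursive k F" "total_recursive k G"
  shows "total_recursive k (\<lambda>xs. F xs * G xs)"
proof -
  \<comment> \<open>With two plain arguments the step function reaches the summand by a projection;
    arbitrary \<open>F\<close> and \<open>G\<close> are substituted afterwards.\<close>
  have *: "total_recursive 2 (\<lambda>xs. rec_nat 0 (\<lambda>n r. r + xs ! 1) (xs ! 0))"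
    by (intro total_recursive_rec_nat total_recursive_const total_recursive_add total_recursive_nth
        total_recursive_hd total_recursive_nth_tl_tl) auto
  have "rec_nat 0 (\<lambda>n r. r + b) a = a * b" for a b :: nat
    by (induction a) auto
  with * have "total_recursive 2 (\<lambda>xs. xs ! 0 * xs ! 1)"
    by simp
  then show ?thesis
    using total_recursive_compose[of "[F, G]" "\<lambda>xs. xs ! 0 * xs ! 1" k] assms
    by (auto simp: numeral_2_eq_2)
qed

lemma total_recursive_power:
  assumes "total_recursive k F"
  shows "total_recursive k (\<lambda>xs. c ^ F xs)"
proof -
  have "total_recursive k (\<lambda>xs. rec_nat 1 (\<lambda>n r. c * r) (F xs))"
    by (intro total_recursive_rec_nat total_recursive_const assms total_recursive_mult
        total_recursive_hd) simp
  moreover have "rec_nat 1 (\<lambda>n r. c * r) a = c ^ a" for a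
    by (induction a) auto
  ultimately show ?thesis by simp
qed

text \<open>With truncated subtraction, \<open>1 - (F xs - G xs)\<close> is the indicator of the
  comparison.\<close>

lemma total_recursive_of_bool_le:
  assumes "total_recursive k F" "total_recursive k G"
  shows "total_recursive k (\<lambda>xs. of_bool (F xs \<le> G xs))"
proof -
  have "total_recursive k (\<lambda>xs. 1 - (F xs - G xs))"
    by (intro total_recursive_diff total_recursive_const assms)
  then show ?thesis
    by (rule total_recursive_cong) auto
qed

lemma total_recursive_of_bool_conj:
  assumes "total_recursive k (\<lambda>xs. of_bool (R xs))" "total_recursive k (\<lambda>xs. of_bool (S xs))"
  shows "total_recursive k (\<lambda>xs. of_bool (R xs \<and> S xs))"
  unfolding of_bool_conj by (intro total_recursive_mult assms)

lemma total_recursive_of_bool_eq: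
  assumes "total_recursive k F" "total_recursive k G"
  shows "total_recursive k (\<lambda>xs. of_bool (F xs = G xs))"
  unfolding order_eq_iff
  by (intro total_recursive_of_bool_conj total_recursive_of_bool_le assms)

lemmas total_recursive_intros =
  total_recursive_nth total_recursive_nth_tl total_recursive_nth_tl_tl
  total_recursive_hd total_recursive_hd_tl
  total_recursive_Suc total_recursive_add total_recursive_diff total_recursive_mult
  total_recursive_power total_recursive_sum total_recursive_of_bool_le
  total_recursive_of_bool_conj total_recursive_of_bool_eq total_recursive_const

section \<open>Computability of the codings of pairs, integers and sequences\<close>

lemma total_recursive_prod_encode:
  assumes "total_recursive k F" "total_recursive k G"
  shows "total_recursive k (\<lambda>xs. prod_encode (F xs, G xs))"
proof -
  \<comment> \<open>Writing triangular numbers as sums avoids division by two.\<close>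
  have "triangle n = (\<Sum>j<Suc n. j)" for n
    by (induction n) auto
  then have *: "prod_encode (a, b) = (\<Sum>j<Suc (a + b). j) + a" for a b
    by (simp add: prod_encode_def)
  show ?thesis
    unfolding * by (intro total_recursive_intros assms) simp
qed

text \<open>Turns a bounded search with a unique solution into arithmetic: the candidates are
  summed, weighted by indicators. The decoding functions are computed in this way.\<close>

lemma sum_of_bool_eq_single:
  fixes f :: "'a \<Rightarrow> 'b :: semiring_1"
  assumes "finite A" "a \<in> A"
  shows "(\<Sum>x\<in>A. f x * of_bool (x = a)) = f a"
  using assms by (simp add: of_bool_def if_distrib[of "(*) _"] cong: if_cong)

text \<open>Both components of a pair are at most its code, so a double sum over that range finds
  them. The auxiliary identity has an arbitrary \<open>f\<close> so that it extracts either
  component.\<close>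

lemma total_recursive_prod_decode:
  assumes "total_recursive k F"
  shows "total_recursive k (\<lambda>xs. fst (prod_decode (F xs)))"
    and "total_recursive k (\<lambda>xs. snd (prod_decode (F xs)))"
proof -
  have *: "(\<Sum>y<Suc w. \<Sum>z<Suc w. f y z * of_bool (prod_encode (y, z) = w)) =
      f (fst (prod_decode w)) (snd (prod_decode w))" for f :: "nat \<Rightarrow> nat \<Rightarrow> nat" and w
  proof -
    obtain a b where w: "w = prod_encode (a, b)"
      by (metis prod_decode_inverse surj_pair)
    have "a < Suc w" "b < Suc w"
      unfolding w by (simp_all add: less_Suc_eq_le le_prod_encode_1 le_prod_encode_2)
    then have "(\<Sum>y<Suc w. (\<Sum>z<Suc w. f y z * of_bool (z = b)) * of_bool (y = a)) = f a b"
      by (subst sum_of_bool_eq_single) (simp_all add: sum_of_bool_eq_single del: sum.lessThan_Suc)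
    moreover have "of_bool (prod_encode (y, z) = w) = (of_bool (z = b) * of_bool (y = a) :: nat)" for y z
      by (auto simp: w)
    ultimately show ?thesis
      by (simp only: w prod_encode_inverse fst_conv snd_conv sum_distrib_right mult.assoc)
  qed
  have "total_recursive 1 (\<lambda>xs. \<Sum>y<Suc (xs ! 0). \<Sum>z<Suc (xs ! 0).
      y * of_bool (prod_encode (y, z) = xs ! 0))"
    by (intro total_recursive_intros total_recursive_prod_encode) auto
  from total_recursive_compose1[OF this[unfolded *] assms]
  show "total_recursive k (\<lambda>xs. fst (prod_decode (F xs)))" .
  have "total_recursive 1 (\<lambda>xs. \<Sum>y<Suc (xs ! 0). \<Sum>z<Suc (xs ! 0).
      z * of_bool (prod_encode (y, z) = xs ! 0))"
    by (intro total_recursive_intros total_recursive_prod_encode) auto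
  from total_recursive_compose1[OF this[unfolded *] assms]
  show "total_recursive k (\<lambda>xs. snd (prod_decode (F xs)))" .
qed

lemma nat_int_decode: "nat (int_decode n) = (if even n then n div 2 else 0)"
  by (auto simp: int_decode_def sum_decode_def)

text \<open>Even codes stand for the nonnegative integers, so the value is the \<open>j\<close> with
  \<open>2 * j = n\<close>, and the sum is 0 for odd \<open>n\<close>. Truncating negative integers
  is harmless below, where endpoints are compared only with grid points on the nonnegative
  half-line.\<close>

lemma total_recursive_nat_int_decode:
  assumes "total_recursive k F"
  shows "total_recursive k (\<lambda>xs. nat (int_decode (F xs)))"
proof -
  have *: "(\<Sum>j<Suc n. j * of_bool (2 * j = n)) = nat (int_decode n)" for n
  proof (cases "even n")
    case True
    then have "2 * j = n \<longleftrightarrow> j = n div 2" for j by auto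
    then show ?thesis
      using sum_of_bool_eq_single[of "{..<Suc n}" "n div 2" "\<lambda>j. j"] True
      by (simp add: nat_int_decode del: sum.lessThan_Suc)
  next
    case False
    then have "2 * j \<noteq> n" for j by auto
    with False show ?thesis by (simp add: nat_int_decode)
  qed
  have "total_recursive 1 (\<lambda>xs. \<Sum>j<Suc (xs ! 0). j * of_bool (2 * j = xs ! 0))"
    by (intro total_recursive_intros) auto
  from total_recursive_compose1[OF this[unfolded *] assms] show ?thesis .
qed

text \<open>Every number codes an infinite sequence: the first component of the pair is the head,
  the second codes the tail. No length is stored, so every number is a valid code.\<close>

definition coded_nth :: "nat \<Rightarrow> nat \<Rightarrow> nat" where
  "coded_nth l j = fst (prod_decode (((\<lambda>w. snd (prod_decode w)) ^^ j) l))"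

lemma coded_nth_surj: "\<exists>l. \<forall>j<g. coded_nth l j = s j"
proof (induction g arbitrary: s)
  case (Suc g)
  from Suc[of "\<lambda>j. s (Suc j)"] obtain l where l: "\<forall>j<g. coded_nth l j = s (Suc j)" by blast
  have "coded_nth (prod_encode (s 0, l)) j = s j" if "j < Suc g" for j
  proof (cases j)
    case (Suc i)
    then have "coded_nth (prod_encode (s 0, l)) j = coded_nth l i"
      by (simp add: coded_nth_def funpow_Suc_right del: funpow.simps)
    then show ?thesis using l that Suc by simp
  qed (simp add: coded_nth_def)
  then show ?case by blast
qed simp

lemma total_recursive_coded_nth:
  assumes "total_recursive k F" "total_recursive k G"
  shows "total_recursive k (\<lambda>xs. coded_nth (F xs) (G xs))"
proof -
  have "total_recursive k (\<lambda>xs. fst (prod_decode (rec_nat (F xs) (\<lambda>n r. snd (prod_decode r)) (G xs))))"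
    by (intro total_recursive_rec_nat total_recursive_prod_decode total_recursive_intros assms) simp
  moreover have "((\<lambda>w. snd (prod_decode w)) ^^ j) l = rec_nat l (\<lambda>n r. snd (prod_decode r)) j" for l j
    by (induction j) auto
  ultimately show ?thesis
    by (simp add: coded_nth_def)
qed

section \<open>Semidecidable relations and computably enumerable sets\<close>

lemma semidecidable_of_bool:
  assumes "total_recursive k (\<lambda>xs. of_bool (R xs))"
  shows "semidecidable k R"
proof -
  have "total_recursive (Suc k) (\<lambda>ys. (\<lambda>xs. of_bool (R xs))
      (map (\<lambda>H. H ys) (map (\<lambda>i xs. xs ! Suc i) [0..<k])))"
    using assms by (intro total_recursive_compose) (auto intro: total_recursive_nth)
  then have "total_recursive (Suc k) (\<lambda>ys. of_bool (R (tl ys)))"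
  proof (rule total_recursive_cong)
    fix ys :: "nat list"
    assume ys: "length ys = Suc k"
    have "map (\<lambda>i. ys ! Suc i) [0..<k] = tl ys"
      using ys by (intro nth_equalityI) (auto simp: nth_tl)
    then show "(\<lambda>xs. of_bool (R xs)) (map (\<lambda>H. H ys) (map (\<lambda>i xs. xs ! Suc i) [0..<k]))
        = (of_bool (R (tl ys)) :: nat)"
      by (simp add: comp_def)
  qed
  then have "total_recursive (Suc k) (\<lambda>ys. 1 - of_bool (R (tl ys)))"
    by (intro total_recursive_intros)
  then obtain f where f: "\<And>xs y. length xs = Suc k \<Longrightarrow> rec_eval f xs y \<longleftrightarrow> y = 1 - of_bool (R (tl xs))"
    unfolding total_recursive_def by blast
  \<comment> \<open>The function under the search ignores the search variable: it is constantly 0 if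
    \<open>R xs\<close> holds and constantly 1 otherwise, so the search stops at once or
    never.\<close>
  have "(\<exists>y. rec_eval (Mu f) xs y) \<longleftrightarrow> R xs" if "length xs = k" for xs
    using that by (auto simp: rec_eval_Mu_iff f)
  then show ?thesis
    unfolding semidecidable_def by blast
qed

text \<open>\<open>Comp\<close> requires all its arguments to converge, so composing
  \<open>Zero\<close> with both programs converges exactly when both do.\<close>

lemma semidecidable_conj:
  assumes "semidecidable k R" "semidecidable k S"
  shows "semidecidable k (\<lambda>xs. R xs \<and> S xs)"
proof -
  obtain f where f: "\<And>xs. length xs = k \<Longrightarrow> (\<exists>y. rec_eval f xs y) \<longleftrightarrow> R xs"
    using assms(1) unfolding semidecidable_def by blast
  obtain g where g: "\<And>xs. length xs = k \<Longrightarrow> (\<exists>y. rec_eval g xs y) \<longleftrightarrow> S xs"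
    using assms(2) unfolding semidecidable_def by blast
  have "(\<exists>y. rec_eval (Comp Zero [f, g]) xs y) \<longleftrightarrow> R xs \<and> S xs" if "length xs = k" for xs
    using f[OF that] g[OF that] by (auto simp: rec_eval_Comp_iff rec_eval_Zero_iff list_all2_Cons1)
  then show ?thesis
    unfolding semidecidable_def by blast
qed

text \<open>A primitive recursion runs the program for \<open>R\<close> at each index below the
  bound and discards the values; it converges iff all these runs do.\<close>

lemma semidecidable_ball:
  assumes N: "total_recursive k N" and R: "semidecidable (Suc k) (\<lambda>ys. R (hd ys) (tl ys))"
  shows "semidecidable k (\<lambda>xs. \<forall>j<N xs. R j xs)"
proof -
  have "semidecidable (Suc (Suc k))
      (\<lambda>ys. (\<lambda>ys. R (hd ys) (tl ys)) (map (\<lambda>H. H ys) (map (\<lambda>i xs. xs ! Suc i) [0..<Suc k])))"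
    using R by (intro semidecidable_compose) (auto intro: total_recursive_nth simp del: upt_Suc)
  then obtain f where f: "\<And>ys. length ys = Suc (Suc k) \<Longrightarrow> (\<exists>y. rec_eval f ys y) \<longleftrightarrow>
      (\<lambda>ys. R (hd ys) (tl ys)) (map (\<lambda>H. H ys) (map (\<lambda>i xs. xs ! Suc i) [0..<Suc k]))"
    unfolding semidecidable_def by blast
  have f': "(\<exists>y. rec_eval f (r # n # xs) y) \<longleftrightarrow> R n xs" if "length xs = k" for r n xs
  proof -
    have "map (\<lambda>i. (r # n # xs) ! Suc i) [0..<Suc k] = n # xs"
      using that by (intro nth_equalityI) (auto simp del: upt_Suc)
    then show ?thesis
      using f[of "r # n # xs"] that by (simp add: comp_def del: upt_Suc)
  qed
  define h where "h = PrimRec Zero (Comp Zero [f])"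
  have h: "rec_eval h (m # xs) y \<longleftrightarrow> y = 0 \<and> (\<forall>j<m. R j xs)" if "length xs = k" for m xs y
    unfolding h_def
    by (induction m arbitrary: y)
       (auto simp: rec_eval_PrimRec_0_iff rec_eval_PrimRec_Suc_iff rec_eval_Comp_iff
          rec_eval_Zero_iff list_all2_Cons1 less_Suc_eq f'[OF that])
  have "(\<exists>y. rec_eval h xs y) \<longleftrightarrow> (\<forall>j<hd xs. R j (tl xs))" if "length xs = Suc k" for xs
    using that by (cases xs) (auto simp: h)
  then have "semidecidable (Suc k) (\<lambda>ys. \<forall>j<hd ys. R j (tl ys))"
    unfolding semidecidable_def by blast
  then have "semidecidable k (\<lambda>xs. (\<lambda>ys. \<forall>j<hd ys. R j (tl ys))
      (map (\<lambda>G. G xs) (N # map (\<lambda>i xs. xs ! i) [0..<k])))"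
    using N by (intro semidecidable_compose) (auto intro: total_recursive_nth)
  then show ?thesis
    unfolding semidecidable_def by (simp add: comp_def map_nth_upt_length)
qed

lemma computably_enumerable_iff_semidecidable:
  "computably_enumerable W \<longleftrightarrow> semidecidable 1 (\<lambda>xs. xs ! 0 \<in> W)"
proof
  assume "computably_enumerable W"
  then obtain f where f: "W = {n. \<exists>y. rec_eval f [n] y}"
    unfolding computably_enumerable_def by blast
  show "semidecidable 1 (\<lambda>xs. xs ! 0 \<in> W)"
    unfolding semidecidable_def f by (rule exI[of _ f]) (auto simp: length_Suc_conv)
next
  assume "semidecidable 1 (\<lambda>xs. xs ! 0 \<in> W)"
  then obtain f where f: "\<And>xs. length xs = 1 \<Longrightarrow> (\<exists>y. rec_eval f xs y) \<longleftrightarrow> xs ! 0 \<in> W"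
    unfolding semidecidable_def by blast
  show "computably_enumerable W"
    unfolding computably_enumerable_def using f[of "[_]"] by auto
qed

text \<open>To test \<open>m\<close>, search for its preimage, which injectivity makes unique, and
  run the program for \<open>V\<close> on it. The search diverges off the range of
  \<open>e\<close>.\<close>

lemma computably_enumerable_inj_image:
  assumes V: "computably_enumerable V" and e: "total_recursive 1 (\<lambda>xs. e (xs ! 0))" and "inj e"
  shows "computably_enumerable (e ` V)"
proof -
  have "total_recursive 2 (\<lambda>xs. 1 - of_bool (e (xs ! 0) = xs ! 1))"
    by (intro total_recursive_intros total_recursive_compose1[OF e]) auto
  then obtain g where g: "\<And>xs y. length xs = 2 \<Longrightarrow>
      rec_eval g xs y \<longleftrightarrow> y = 1 - of_bool (e (xs ! 0) = xs ! 1)"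
    unfolding total_recursive_def by blast
  obtain f where f: "V = {n. \<exists>y. rec_eval f [n] y}"
    using V unfolding computably_enumerable_def by blast
  have "rec_eval (Mu g) [m] v \<longleftrightarrow> e v = m" for m v
    using \<open>inj e\<close> by (auto simp: rec_eval_Mu_iff g dest: injD)
  then have "(\<exists>y. rec_eval (Comp f [Mu g]) [m] y) \<longleftrightarrow> m \<in> e ` V" for m
    unfolding f by (auto simp: rec_eval_Comp_iff list_all2_Cons1)
  then show ?thesis
    unfolding computably_enumerable_def by blast
qed

section \<open>Effective openness of the union of the dense dyadic intervals\<close>

lemma rational_interval_eq:
  "rational_interval i =
    {real_of_int (int_decode (fst (prod_decode (fst (prod_decode i))))) / (real (snd (prod_decode i)) + 1) <..<
     real_of_int (int_decode (snd (prod_decode (fst (prod_decode i))))) / (real (snd (prod_decode i)) + 1)}"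
  by (simp add: rational_interval_def Let_def case_prod_beta)

lemma effectively_open_Union:
  assumes V: "computably_enumerable V"
    and r: "total_recursive 1 (\<lambda>xs. r (xs ! 0))" and d: "total_recursive 1 (\<lambda>xs. d (xs ! 0))"
    and d_pos: "\<And>v. 0 < d v"
  shows "effectively_open (\<Union>v\<in>V. {real (r v) / real (d v) <..< (real (r v) + 1) / real (d v)})"
proof -
  text \<open>The fractions are expanded by \<open>v + 1\<close>, so that \<open>v\<close> can be recovered from the index:
    it is the difference of the numerators, minus one. Hence no dovetailing is needed.\<close>
  define e where "e v = prod_encode (prod_encode (2 * (r v * Suc v), 2 * (Suc (r v) * Suc v)),
    d v * Suc v - 1)" for v
  have "total_recursive 1 (\<lambda>xs. e (xs ! 0))"
    unfolding e_def by (intro total_recursive_intros total_recursive_prod_encode r d) auto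
  moreover have "inj e"
    by (rule injI) (auto simp: e_def)
  ultimately have ce: "computably_enumerable (e ` V)"
    using V by (intro computably_enumerable_inj_image)
  have "rational_interval (e v) = {real (r v) / real (d v) <..< (real (r v) + 1) / real (d v)}" for v
  proof -
    have int_decode_double: "int_decode (2 * n) = int n" for n
      by (simp add: int_decode_def sum_decode_def)
    \<comment> \<open>The index stores the denominator decreased by one, since
      \<open>rational_interval\<close> adds it back.\<close>
    have "0 < d v * Suc v"
      using d_pos by simp
    then have "real (d v * Suc v - 1) + 1 = real (d v) * real (Suc v)"
      by (metis Suc_pred' add.commute of_nat_Suc of_nat_mult)
    then show ?thesis
      by (simp add: rational_interval_eq e_def int_decode_double del: mult_Suc_right mult_Suc of_nat_Suc)
         (simp add: algebra_simps)
  qed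
  then show ?thesis
    unfolding effectively_open_def using ce by (intro exI[of _ "e ` V"]) simp
qed

section \<open>Grid cells inside rational intervals, decided in natural numbers\<close>

definition grid_cell :: "nat \<Rightarrow> nat \<Rightarrow> real set" where
  "grid_cell M x = {real x / real M <..< (real x + 1) / real M}"

lemma nat_mult_int: "nat (a * int e) = nat a * e"
proof (cases "0 \<le> a")
  case False
  then have "a * int e \<le> 0" by (simp add: mult_nonpos_nonneg)
  with False show ?thesis by simp
qed (simp add: nat_mult_distrib)

lemma nat_floor_bounds:
  fixes x :: real
  assumes "0 \<le> x"
  shows "real (nat \<lfloor>x\<rfloor>) \<le> x" "x < real (Suc (nat \<lfloor>x\<rfloor>))"
  using assms by linarith+

text \<open>Replacing \<open>a\<close> by \<open>nat a\<close> is sound because grid points are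
  nonnegative: for negative \<open>a\<close> both inequalities hold.\<close>

lemma of_int_divide_le_iff:
  assumes "0 < M"
  shows "real_of_int a / (real c + 1) \<le> real x / real M \<longleftrightarrow> nat a * M \<le> x * Suc c"
proof -
  have "real_of_int a / (real c + 1) \<le> real x / real M \<longleftrightarrow>
      real_of_int (a * int M) \<le> real_of_int (int x * int (Suc c))"
    using assms by (simp add: field_simps)
  also have "\<dots> \<longleftrightarrow> a * int M \<le> int (x * Suc c)"
    by (simp only: of_int_le_iff of_nat_mult)
  also have "\<dots> \<longleftrightarrow> nat a * M \<le> x * Suc c"
    by (simp only: nat_le_iff flip: nat_mult_int)
  finally show ?thesis .
qed

lemma of_nat_divide_le_iff:
  assumes "0 < M"
  shows "real (Suc x) / real M \<le> real_of_int b / (real c + 1) \<longleftrightarrow> Suc x * Suc c \<le> nat b * M"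
proof -
  have "real (Suc x) / real M \<le> real_of_int b / (real c + 1) \<longleftrightarrow>
      real_of_int (int (Suc x) * int (Suc c)) \<le> real_of_int (b * int M)"
    using assms by (simp add: field_simps)
  also have "\<dots> \<longleftrightarrow> int (Suc x * Suc c) \<le> b * int M"
    by (simp only: of_int_le_iff of_nat_mult)
  \<comment> \<open>The left side is positive, so a negative \<open>b * int M\<close> violates the
    inequality both before and after truncation.\<close>
  also have "\<dots> \<longleftrightarrow> Suc x * Suc c \<le> nat (b * int M)"
    using zero_less_Suc[of "c + x * Suc c"] by (simp only: mult_Suc add_Suc) linarith
  also have "\<dots> \<longleftrightarrow> Suc x * Suc c \<le> nat b * M"
    by (simp only: nat_mult_int)
  finally show ?thesis .
qed

text \<open>A cell is nonempty, so inclusion amounts to two endpoint comparisons. Clearing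
  denominators makes them comparisons of natural numbers, hence decidable.\<close>

lemma grid_cell_subset_rational_interval_iff:
  assumes "0 < M"
  shows "grid_cell M x \<subseteq> rational_interval i \<longleftrightarrow>
    nat (int_decode (fst (prod_decode (fst (prod_decode i))))) * M \<le> x * Suc (snd (prod_decode i)) \<and>
    Suc x * Suc (snd (prod_decode i)) \<le> nat (int_decode (snd (prod_decode (fst (prod_decode i))))) * M"
proof -
  have "real x / real M < (real x + 1) / real M"
    using assms by (simp add: divide_strict_right_mono)
  moreover have "real x + 1 = real (Suc x)" by simp
  ultimately show ?thesis
    unfolding grid_cell_def rational_interval_eq greaterThanLessThan_subseteq_greaterThanLessThan
    using assms by (simp only: of_int_divide_le_iff of_nat_divide_le_iff simp_thms)
qed

section \<open>Counts of covered cells as finite evidence for measure\<close>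

definition covered_cells :: "nat \<Rightarrow> nat \<Rightarrow> nat \<Rightarrow> (nat \<Rightarrow> nat) \<Rightarrow> nat set" where
  "covered_cells d r g s = {j. j < g \<and> grid_cell (d * g) (r * g + j) \<subseteq> rational_interval (s j)}"

lemma half_open_cell_subset:
  assumes "0 < d" "j < g"
  shows "{real (r * g + j) / real (d * g) ..< (real (r * g + j) + 1) / real (d * g)}
    \<subseteq> {real r / real d ..< (real r + 1) / real d}"
proof -
  have "real r / real d = real (r * g) / real (d * g)"
    using assms by simp
  also have "\<dots> \<le> real (r * g + j) / real (d * g)"
    by (intro divide_right_mono) auto
  finally have 1: "real r / real d \<le> real (r * g + j) / real (d * g)" .
  have "real (r * g + j) + 1 = real (r * g + Suc j)"
    by simp
  also have "\<dots> \<le> real (Suc r * g)"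
    using assms by (subst of_nat_le_iff) simp
  finally have "(real (r * g + j) + 1) / real (d * g) \<le> real (Suc r * g) / real (d * g)"
    by (intro divide_right_mono) auto
  also have "\<dots> = (real r + 1) / real d"
    using assms by (simp add: field_simps)
  finally have 2: "(real (r * g + j) + 1) / real (d * g) \<le> (real r + 1) / real d" .
  from 1 2 show ?thesis
    by (auto intro: order_trans less_le_trans)
qed

lemma lmeasurable_half_open [simp]:
  fixes a b :: real
  shows "{a..<b} \<in> lmeasurable"
  by (rule fmeasurableI2[of "{a..b}"]) auto

text \<open>Soundness of the evidence: the interval is cut into \<open>g\<close> cells of length
  \<open>1 / (d * g)\<close>, and the counted ones are disjoint and lie in the measured set.\<close>

lemma measure_ge_covered_cells:
  assumes "0 < d" "0 < g" and s: "\<And>j. j < g \<Longrightarrow> s j \<in> W"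
  shows "real (card (covered_cells d r g s)) / real (d * g) \<le>
    measure lebesgue ({real r / real d ..< (real r + 1) / real d} \<inter> (\<Union>i\<in>W. rational_interval i))"
    (is "_ \<le> measure lebesgue ?S")
proof -
  let ?c = "\<lambda>j. grid_cell (d * g) (r * g + j)"
  have M: "0 < d * g" using assms by simp
  have "pairwise (\<lambda>i j. disjnt (?c i) (?c j)) (covered_cells d r g s)"
  proof -
    have *: "grid_cell (d * g) x \<inter> grid_cell (d * g) y = {}" if "x < y" for x y
    proof -
      have "real x + 1 \<le> real y" using that by linarith
      then have "(real x + 1) / real (d * g) \<le> real y / real (d * g)"
        by (rule divide_right_mono) simp
      then show ?thesis by (auto simp: grid_cell_def simp del: of_nat_mult)
    qed
    show ?thesis
      unfolding pairwise_def disjnt_def using *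
      by (metis Int_commute linorder_neqE_nat nat_add_left_cancel_less)
  qed
  moreover have "?c j \<in> lmeasurable" for j
    by (simp add: grid_cell_def)
  ultimately have "measure lebesgue (\<Union>j\<in>covered_cells d r g s. ?c j) =
      (\<Sum>j\<in>covered_cells d r g s. measure lebesgue (?c j))"
    by (intro measure_UNION') (auto simp: covered_cells_def)
  also have "\<dots> = (\<Sum>j\<in>covered_cells d r g s. 1 / real (d * g))"
    using M by (intro sum.cong refl) (simp add: grid_cell_def divide_right_mono flip: diff_divide_distrib)
  also have "\<dots> = real (card (covered_cells d r g s)) / real (d * g)"
    by simp
  finally have eq: "measure lebesgue (\<Union>j\<in>covered_cells d r g s. ?c j) =
    real (card (covered_cells d r g s)) / real (d * g)" .
  have "(\<Union>j\<in>covered_cells d r g s. ?c j) \<subseteq> ?S"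
  proof -
    have "?c j \<subseteq> ?S" if "j \<in> covered_cells d r g s" for j
    proof -
      from that have j: "j < g" "?c j \<subseteq> rational_interval (s j)"
        by (auto simp: covered_cells_def)
      have "?c j \<subseteq> {real (r * g + j) / real (d * g) ..< (real (r * g + j) + 1) / real (d * g)}"
        by (auto simp: grid_cell_def)
      with half_open_cell_subset[OF assms(1) j(1)] j s show ?thesis by blast
    qed
    then show ?thesis by blast
  qed
  moreover have "open (\<Union>i\<in>W. rational_interval i)"
    by (auto simp: rational_interval_eq)
  then have "?S \<in> lmeasurable"
    by (intro fmeasurable_Int_fmeasurable) auto
  moreover have "(\<Union>j\<in>covered_cells d r g s. ?c j) \<in> sets lebesgue"
    by (intro sets.finite_UN) (auto simp: covered_cells_def grid_cell_def)
  ultimately show ?thesis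
    unfolding eq[symmetric] by (intro measure_mono_fmeasurable)
qed

text \<open>The grid of mesh \<open>1 / M\<close> contains both endpoints of the interval, so a cell that meets the
  interval lies inside it.\<close>
lemma half_open_cell_subset_rational_interval:
  assumes "0 < M" "Suc (snd (prod_decode i)) dvd M" "0 \<le> x" "x \<in> rational_interval i"
  shows "grid_cell M (nat \<lfloor>x * real M\<rfloor>) \<subseteq> rational_interval i"
proof -
  define c where "c = snd (prod_decode i)"
  define a where "a = int_decode (fst (prod_decode (fst (prod_decode i))))"
  define b where "b = int_decode (snd (prod_decode (fst (prod_decode i))))"
  define y where "y = nat \<lfloor>x * real M\<rfloor>"
  obtain e where e: "M = Suc c * e"
    using assms(2) unfolding c_def by blast
  have y: "real y \<le> x * real M" "x * real M < real (Suc y)"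
    using assms(3) nat_floor_bounds[of "x * real M"] unfolding y_def by auto
  have "real_of_int a / (real c + 1) < x" "x < real_of_int b / (real c + 1)"
    using assms(4) unfolding rational_interval_eq a_def b_def c_def by auto
  then have ab: "real_of_int a < x * (real c + 1)" "x * (real c + 1) < real_of_int b"
    by (auto simp: field_simps)
  have "0 < e" using assms(1) e by (cases e) auto
  have xM: "x * real M = x * (real c + 1) * real e"
    unfolding e by (simp add: algebra_simps)
  \<comment> \<open>Scaled by \<open>M\<close>, the endpoints become the integers
    \<open>a * e\<close> and \<open>b * e\<close>, so the strict inequalities around
    \<open>x * M\<close> sharpen to \<open>a * e \<le> y\<close> and
    \<open>y + 1 \<le> b * e\<close>.\<close>
  have "real_of_int (a * int e) < real_of_int (int (Suc y))"
    using less_trans[OF mult_strict_right_mono[OF ab(1), of "real e"] y(2)[unfolded xM]] \<open>0 < e\<close>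
    by simp
  then have ay: "a * int e \<le> int y"
    unfolding of_int_less_iff by simp
  have "real_of_int (int y) < real_of_int (b * int e)"
    using le_less_trans[OF y(1)[unfolded xM] mult_strict_right_mono[OF ab(2), of "real e"]] \<open>0 < e\<close>
    by simp
  then have b_ge: "int (Suc y) \<le> b * int e"
    unfolding of_int_less_iff by simp
  have "nat a * e \<le> y"
    using ay by (simp only: nat_le_iff flip: nat_mult_int)
  moreover have "Suc y \<le> nat b * e"
    unfolding nat_mult_int[symmetric] using b_ge by linarith
  ultimately have "nat a * M \<le> y * Suc c \<and> Suc y * Suc c \<le> nat b * M"
    unfolding e by (metis mult.assoc mult.commute mult_le_mono1)
  then show ?thesis
    unfolding grid_cell_subset_rational_interval_iff[OF assms(1)] y_def a_def b_def c_def by simp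
qed

text \<open>Completeness of the evidence: by continuity from below, finitely many rational intervals
  already carry measure above \<open>c\<close>. On a grid containing all their endpoints, a
  half-open cell that meets one of them has its interior inside it.\<close>

lemma exists_covered_cells:
  assumes "0 < d" "0 \<le> c"
    and dense: "c < measure lebesgue
      ({real r / real d ..< (real r + 1) / real d} \<inter> (\<Union>i\<in>W. rational_interval i))"
      (is "_ < measure lebesgue (?H \<inter> ?U)")
  obtains g s where "0 < g" "\<And>j. s j \<in> W"
    "c < real (card (covered_cells d r g s)) / real (d * g)"
proof -
  define A where "A n = ?H \<inter> (\<Union>i\<in>W \<inter> {..<n}. rational_interval i)" for n
  have open_I: "open (\<Union>i\<in>S. rational_interval i)" for S
    by (auto simp: rational_interval_eq)
  have "A n \<in> sets lebesgue" for n
    unfolding A_def using open_I[of "W \<inter> {..<n}"] by (intro sets.Int) auto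
  moreover have "incseq A"
    unfolding A_def by (intro monoI) auto
  moreover have A_Un: "(\<Union>n. A n) = ?H \<inter> ?U"
    unfolding A_def by (auto intro: lessI)
  moreover have "?H \<inter> ?U \<in> lmeasurable"
    using open_I[of W] by (intro fmeasurable_Int_fmeasurable) auto
  ultimately have "(\<lambda>n. measure lebesgue (A n)) \<longlonglongrightarrow> measure lebesgue (?H \<inter> ?U)"
    using Lim_measure_incseq[of A lebesgue] fmeasurableD2[of "?H \<inter> ?U" lebesgue]
    by (metis image_subsetI infinity_ennreal_def)
  from order_tendstoD(1)[OF this dense] obtain n where n: "c < measure lebesgue (A n)"
    by (auto simp: eventually_sequentially)
  \<comment> \<open>Supplies a default \<open>w\<close>: \<open>s\<close> has to name an element of
    \<open>W\<close> even for cells that lie in no enumerated interval.\<close>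
  have "W \<noteq> {}"
    using dense \<open>0 \<le> c\<close> by auto
  then obtain w where "w \<in> W" by blast
  \<comment> \<open>A common multiple of the denominators of the first \<open>n\<close> intervals,
    so that their endpoints lie on the grid of mesh \<open>1 / (d * g)\<close>.\<close>
  define g where "g = (\<Prod>i<n. Suc (snd (prod_decode i)))"
  have "0 < g"
    unfolding g_def by (intro prod_pos) simp
  define M where "M = d * g"
  have "0 < M"
    using assms(1) \<open>0 < g\<close> by (simp add: M_def)
  define s where "s j = (if \<exists>i\<in>W. grid_cell M (r * g + j) \<subseteq> rational_interval i
    then SOME i. i \<in> W \<and> grid_cell M (r * g + j) \<subseteq> rational_interval i else w)" for j
  have sW: "s j \<in> W" for j
    unfolding s_def using \<open>w \<in> W\<close> by (auto intro: someI2)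
  have s: "grid_cell M (r * g + j) \<subseteq> rational_interval (s j)"
    if "i \<in> W" "grid_cell M (r * g + j) \<subseteq> rational_interval i" for i j
    using that unfolding s_def by (auto intro: someI2)
  \<comment> \<open>Half-open cells also cover the grid points and have the same length as the open
    ones.\<close>
  define H where "H j = {real (r * g + j) / real M ..< (real (r * g + j) + 1) / real M}" for j
  have "A n \<subseteq> (\<Union>j\<in>covered_cells d r g s. H j)"
  proof
    fix x
    assume "x \<in> A n"
    then obtain i where x: "real r / real d \<le> x" "x < (real r + 1) / real d"
      and i: "i \<in> W" "i < n" "x \<in> rational_interval i"
      by (auto simp: A_def)
    define y where "y = nat \<lfloor>x * real M\<rfloor>"
    have "0 \<le> x"
      using x(1) by (meson divide_nonneg_nonneg of_nat_0_le_iff order_trans)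
    then have y: "real y \<le> x * real M" "x * real M < real (Suc y)"
      using nat_floor_bounds[of "x * real M"] unfolding y_def by auto
    have "Suc (snd (prod_decode i)) dvd M"
      unfolding M_def g_def using i(2) by (intro dvd_mult dvd_prodI) auto
    then have cell: "grid_cell M y \<subseteq> rational_interval i"
      unfolding y_def using \<open>0 < M\<close> \<open>0 \<le> x\<close> i(3)
      by (intro half_open_cell_subset_rational_interval)
    have "real r \<le> x * real d" "x * real d < real r + 1"
      using x assms(1) by (auto simp: field_simps)
    then have "real r * real g \<le> x * real M" "x * real M < (real r + 1) * real g"
      using \<open>0 < g\<close> by (auto simp: M_def simp flip: mult.assoc)
    then have "real (r * g) < real (Suc y)" "real y < real (Suc r * g)"
      using y by (auto simp: algebra_simps)
    then have "r * g \<le> y" "y < r * g + g"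
      unfolding of_nat_less_iff by auto
    then obtain j where j: "y = r * g + j" "j < g"
      by (metis le_Suc_ex nat_add_left_cancel_less)
    have "j \<in> covered_cells d r g s"
      using s[OF i(1)] cell j by (auto simp: covered_cells_def M_def)
    moreover have "x \<in> H j"
      unfolding H_def j(1)[symmetric] using y \<open>0 < M\<close> by (auto simp: field_simps)
    ultimately show "x \<in> (\<Union>j\<in>covered_cells d r g s. H j)" by blast
  qed
  then have "measure lebesgue (A n) \<le> measure lebesgue (\<Union>j\<in>covered_cells d r g s. H j)"
    using \<open>A n \<in> sets lebesgue\<close>
    by (intro measure_mono_fmeasurable fmeasurable.finite_UN)
       (auto simp: H_def covered_cells_def)
  also have "\<dots> \<le> (\<Sum>j\<in>covered_cells d r g s. measure lebesgue (H j))"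
    by (intro measure_UNION_le) (auto simp: covered_cells_def H_def)
  also have "\<dots> = (\<Sum>j\<in>covered_cells d r g s. 1 / real M)"
    unfolding H_def
    by (intro sum.cong refl) (simp add: divide_right_mono flip: diff_divide_distrib)
  finally have "c < real (card (covered_cells d r g s)) / real M"
    using n by simp
  with that \<open>0 < g\<close> sW show thesis
    unfolding M_def by blast
qed

text \<open>Exhibits the count as a bounded sum of decidable indicators, the form in which it is
  shown to be computable.\<close>

lemma card_covered_cells:
  assumes "0 < d"
  shows "card (covered_cells d r g s) = (\<Sum>j<g. of_bool (
    nat (int_decode (fst (prod_decode (fst (prod_decode (s j)))))) * (d * g) \<le>
      (r * g + j) * Suc (snd (prod_decode (s j))) \<and>
    Suc (r * g + j) * Suc (snd (prod_decode (s j))) \<le>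
      nat (int_decode (snd (prod_decode (fst (prod_decode (s j)))))) * (d * g)))"
    (is "_ = (\<Sum>j<g. of_bool (?Q j))")
proof -
  have "grid_cell (d * g) (r * g + j) \<subseteq> rational_interval (s j) \<longleftrightarrow> ?Q j" if "j < g" for j
    using that assms by (intro grid_cell_subset_rational_interval_iff) simp
  then have "covered_cells d r g s = {j \<in> {..<g}. ?Q j}"
    unfolding covered_cells_def by blast
  moreover have "card {j \<in> {..<g}. Q j} = (\<Sum>j<g. of_bool (Q j))" for Q
    by (simp add: of_bool_def sum.If_cases Int_def)
  ultimately show ?thesis by (simp only:)
qed

text \<open>A code packs a dyadic interval, a subdivision and a list of indices of rational
  intervals. Its validity is semidecidable: membership of the indices in \<open>W\<close> together
  with a decidable count. Soundness and completeness of the evidence show that the valid codes yield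
  exactly the dense intervals.\<close>

lemma effectively_open_dense_cells:
  assumes "effectively_open U"
  shows "effectively_open (\<Union>(r, n) \<in> {(r, n).
      1 / 2 ^ (m + n) < real K * measure lebesgue ({real r / 2 ^ (m + n) ..< (real r + 1) / 2 ^ (m + n)} \<inter> U)}.
    {real r / 2 ^ (m + n) <..< (real r + 1) / 2 ^ (m + n)})"
    (is "effectively_open (\<Union>(r, n) \<in> ?D. ?J r n)")
proof -
  obtain W where W: "computably_enumerable W" and U: "U = (\<Union>i\<in>W. rational_interval i)"
    using assms unfolding effectively_open_def by blast
  define r where "r v = fst (prod_decode v)" for v
  define n where "n v = fst (prod_decode (snd (prod_decode v)))" for v
  define g where "g v = fst (prod_decode (snd (prod_decode (snd (prod_decode v)))))" for v
  define l where "l v = snd (prod_decode (snd (prod_decode (snd (prod_decode v)))))" for v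
  define d :: "nat \<Rightarrow> nat" where "d v = 2 ^ (m + n v)" for v
  note defs = r_def n_def g_def l_def d_def
  have d_pos: "0 < d v" for v by (simp add: d_def)
  \<comment> \<open>The second condition is \<open>1 / d < K * card / (d * g)\<close> with
    denominators cleared; it also forces \<open>g\<close> to be positive.\<close>
  define V where "V = {v. (\<forall>j<g v. coded_nth (l v) j \<in> W) \<and>
    g v < K * card (covered_cells (d v) (r v) (g v) (coded_nth (l v)))}"
  have "semidecidable 1 (\<lambda>xs. xs ! 0 \<in> V)"
    unfolding V_def mem_Collect_eq
  proof (rule semidecidable_conj[OF semidecidable_ball semidecidable_of_bool])
    show "total_recursive 1 (\<lambda>xs. g (xs ! 0))"
      unfolding defs by (intro total_recursive_prod_decode total_recursive_intros) simp
    have "total_recursive (Suc 1) (\<lambda>ys. coded_nth (l (tl ys ! 0)) (hd ys))"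
      unfolding defs
      by (intro total_recursive_coded_nth total_recursive_prod_decode total_recursive_intros) auto
    then show "semidecidable (Suc 1) (\<lambda>ys. coded_nth (l (tl ys ! 0)) (hd ys) \<in> W)"
      using semidecidable_compose[of "[\<lambda>ys. coded_nth (l (tl ys ! 0)) (hd ys)]" "\<lambda>xs. xs ! 0 \<in> W"]
        W[unfolded computably_enumerable_iff_semidecidable] by simp
    show "total_recursive 1 (\<lambda>xs. of_bool (g (xs ! 0) < K *
        card (covered_cells (d (xs ! 0)) (r (xs ! 0)) (g (xs ! 0)) (coded_nth (l (xs ! 0))))))"
      unfolding card_covered_cells[OF d_pos] Suc_le_eq[symmetric] unfolding defs
      by (intro total_recursive_nat_int_decode total_recursive_coded_nth
          total_recursive_prod_decode total_recursive_intros) auto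
  qed
  then have "effectively_open (\<Union>v\<in>V. {real (r v) / real (d v) <..< (real (r v) + 1) / real (d v)})"
  proof (intro effectively_open_Union d_pos)
    show "total_recursive 1 (\<lambda>xs. r (xs ! 0))"
      unfolding defs by (intro total_recursive_prod_decode total_recursive_intros) simp
    show "total_recursive 1 (\<lambda>xs. d (xs ! 0))"
      unfolding defs by (intro total_recursive_prod_decode total_recursive_intros) simp
  qed (simp add: computably_enumerable_iff_semidecidable)
  moreover have "(\<Union>v\<in>V. {real (r v) / real (d v) <..< (real (r v) + 1) / real (d v)}) = (\<Union>(r, n)\<in>?D. ?J r n)"
  proof (intro subset_antisym UN_least)
    fix v
    assume "v \<in> V"
    then have W: "\<And>j. j < g v \<Longrightarrow> coded_nth (l v) j \<in> W"
      and less: "g v < K * card (covered_cells (d v) (r v) (g v) (coded_nth (l v)))"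
      by (auto simp: V_def)
    have "0 < g v"
      using less by (cases "g v") (auto simp: covered_cells_def)
    let ?N = "card (covered_cells (d v) (r v) (g v) (coded_nth (l v)))"
    have "real (g v) < real K * real ?N"
      using less by (simp flip: of_nat_mult)
    then have "1 / real (d v) < real K * (real ?N / real (d v * g v))"
      using d_pos[of v] \<open>0 < g v\<close> by (simp add: field_simps)
    also have "\<dots> \<le> real K * measure lebesgue ({real (r v) / real (d v) ..< (real (r v) + 1) / real (d v)} \<inter> U)"
      unfolding U by (intro mult_left_mono measure_ge_covered_cells d_pos \<open>0 < g v\<close> W) auto
    finally have "(r v, n v) \<in> ?D"
      by (simp add: d_def)
    then show "{real (r v) / real (d v) <..< (real (r v) + 1) / real (d v)} \<subseteq> (\<Union>(r, n)\<in>?D. ?J r n)"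
      by (intro UN_upper[of "(r v, n v)" ?D "\<lambda>(r, n). ?J r n", THEN subset_trans[rotated]])
         (auto simp: d_def)
  next
    fix p
    assume "p \<in> ?D"
    then obtain a b where p: "p = (a, b)" and dense: "1 / real (2 ^ (m + b)) < real K *
        measure lebesgue ({real a / real (2 ^ (m + b)) ..< (real a + 1) / real (2 ^ (m + b))} \<inter> U)"
      by auto
    define D :: nat where "D = 2 ^ (m + b)"
    have "0 < D" by (simp add: D_def)
    have "0 < K"
      using dense by (cases K) (auto simp: field_simps)
    then have "1 / (real D * real K) <
        measure lebesgue ({real a / real D ..< (real a + 1) / real D} \<inter> (\<Union>i\<in>W. rational_interval i))"
      using dense unfolding D_def[symmetric] U divide_divide_eq_left[symmetric]
      by (subst pos_divide_less_eq) (simp_all add: mult.commute)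
    then obtain h s where h: "0 < h" and s: "\<And>j. s j \<in> W"
      and less: "1 / (real D * real K) < real (card (covered_cells D a h s)) / real (D * h)"
      by (rule exists_covered_cells[OF \<open>0 < D\<close>, rotated]) auto
    have "real h < real (K * card (covered_cells D a h s))"
      using less \<open>0 < D\<close> \<open>0 < K\<close> h by (simp add: field_simps)
    then have less': "h < K * card (covered_cells D a h s)"
      unfolding of_nat_less_iff .
    \<comment> \<open>Only the first \<open>h\<close> values of \<open>s\<close> are coded;
      \<open>covered_cells\<close> reads no others.\<close>
    obtain w where w: "\<And>j. j < h \<Longrightarrow> coded_nth w j = s j"
      using coded_nth_surj by metis
    define v where "v = prod_encode (a, prod_encode (b, prod_encode (h, w)))"
    have v: "r v = a" "n v = b" "g v = h" "l v = w" "d v = D"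
      by (simp_all add: defs v_def D_def)
    have "covered_cells D a h (coded_nth w) = covered_cells D a h s"
      by (auto simp: covered_cells_def w)
    then have "v \<in> V"
      using less' s by (simp add: V_def v w)
    then show "(\<lambda>(r, n). ?J r n) p \<subseteq>
        (\<Union>v\<in>V. {real (r v) / real (d v) <..< (real (r v) + 1) / real (d v)})"
      by (intro subset_trans[OF _ UN_upper[of v]]) (auto simp: v p D_def)
  qed
  ultimately show ?thesis by simp
qed

lemma open_effectively_open: "effectively_open U \<Longrightarrow> open U"
  by (auto simp: effectively_open_def rational_interval_eq)

section \<open>Density and porosity\<close>

text \<open>Take the least \<open>k\<close> with \<open>1 / 2 ^ k \<le> L\<close>. Minimality gives
  the lower bound \<open>L / 2\<close>, and \<open>L < 1 / 2 ^ m\<close> forces \<open>k\<close>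
  beyond \<open>m\<close>.\<close>

lemma exists_dyadic_scale:
  fixes L :: real
  assumes "0 < L" "L < 1 / 2 ^ m"
  obtains n where "L / 2 < 1 / 2 ^ (m + n)" "1 / 2 ^ (m + n) \<le> L"
proof -
  have "\<exists>k. 1 / 2 ^ k \<le> L"
    using real_arch_pow_inv[of L "1 / 2"] assms(1) by (auto simp: power_one_over intro: less_imp_le)
  then obtain k where k: "1 / 2 ^ k \<le> L" "\<And>i. i < k \<Longrightarrow> \<not> 1 / 2 ^ i \<le> L"
    using exists_least_iff[of "\<lambda>k. 1 / 2 ^ k \<le> L"] by blast
  have "m < k"
  proof (rule ccontr)
    assume "\<not> m < k"
    then have "1 / 2 ^ m \<le> (1 / 2 ^ k :: real)"
      by (intro divide_left_mono power_increasing) auto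
    with k(1) assms(2) show False by linarith
  qed
  then obtain n where n: "k = m + Suc n"
    using less_imp_Suc_add by auto
  have "L < 1 / 2 ^ (m + n)"
    using k(2)[of "m + n"] n by simp
  then show thesis
    using k(1) n by (intro that[of "Suc n"]) simp_all
qed

text \<open>The cells at the two ends may stick out of \<open>{A..B}\<close>; this is why the density is doubled.\<close>
lemma exists_dense_cell:
  fixes A B :: real
  assumes "0 \<le> A" "A < B" "0 < h" "h \<le> (B - A) / 2" "0 < K" "open U"
    and dense: "2 * (B - A) / K < measure lebesgue ({A..B} \<inter> U)"
  obtains r :: nat where "h < K * measure lebesgue ({real r * h ..< (real r + 1) * h} \<inter> U)"
    "A - h < real r * h" "real r * h \<le> B"
proof -
  define r0 where "r0 = nat \<lfloor>A / h\<rfloor>"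
  define r1 where "r1 = nat \<lfloor>B / h\<rfloor>"
  let ?H = "\<lambda>r. {real r * h ..< (real r + 1) * h} \<inter> U"
  have r0: "real r0 \<le> A / h" "A / h < real r0 + 1"
    using assms nat_floor_bounds[of "A / h"] by (auto simp: r0_def)
  have r1: "real r1 \<le> B / h" "B / h < real r1 + 1"
    using assms nat_floor_bounds[of "B / h"] by (auto simp: r1_def)
  have U: "U \<in> sets lebesgue" using \<open>open U\<close> by auto
  have sub: "{A..B} \<inter> U \<subseteq> (\<Union>r\<in>{r0..r1}. ?H r)"
  proof
    fix x
    assume x: "x \<in> {A..B} \<inter> U"
    define r where "r = nat \<lfloor>x / h\<rfloor>"
    have "real r \<le> x / h" "x / h < real r + 1"
      using assms x nat_floor_bounds[of "x / h"] by (auto simp: r_def)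
    then have "x \<in> ?H r"
      using x \<open>0 < h\<close> by (auto simp: field_simps)
    moreover have "r \<in> {r0..r1}"
      using x \<open>0 < h\<close> by (auto simp: r_def r0_def r1_def intro!: nat_mono floor_mono divide_right_mono)
    ultimately show "x \<in> (\<Union>r\<in>{r0..r1}. ?H r)" by blast
  qed
  have "\<exists>r\<in>{r0..r1}. h / K < measure lebesgue (?H r)"
  proof (rule ccontr)
    assume "\<not> ?thesis"
    then have small: "measure lebesgue (?H r) \<le> h / K" if "r \<in> {r0..r1}" for r
      using that by force
    have "measure lebesgue ({A..B} \<inter> U) \<le> measure lebesgue (\<Union>r\<in>{r0..r1}. ?H r)"
      using sub U by (intro measure_mono_fmeasurable fmeasurable.finite_UN fmeasurable_Int_fmeasurable) auto
    also have "\<dots> \<le> (\<Sum>r\<in>{r0..r1}. measure lebesgue (?H r))"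
      using U by (intro measure_UNION_le sets.Int) auto
    also have "\<dots> \<le> (\<Sum>r\<in>{r0..r1}. h / K)"
      by (intro sum_mono small)
    also have "\<dots> = real (card {r0..r1}) * h / K" by simp
    also have "\<dots> \<le> 2 * (B - A) / K"
    proof (intro divide_right_mono)
      have "r0 \<le> r1"
        unfolding r0_def r1_def using assms by (intro nat_mono floor_mono divide_right_mono) auto
      then have "real (card {r0..r1}) = real r1 - real r0 + 1"
        by (simp add: of_nat_diff)
      \<comment> \<open>The inclusive count and the rounding of \<open>r0\<close> cost at most one
        cell each; \<open>h \<le> (B - A) / 2\<close> absorbs the resulting
        \<open>2 * h\<close>.\<close>
      also have "\<dots> \<le> B / h - A / h + 2"
        using r0 r1 by linarith
      finally have "real (card {r0..r1}) * h \<le> (B / h - A / h + 2) * h"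
        using \<open>0 < h\<close> by (intro mult_right_mono) auto
      also have "\<dots> = B - A + 2 * h"
        using \<open>0 < h\<close> by (simp add: field_simps)
      also have "\<dots> \<le> 2 * (B - A)"
        using assms(4) by (simp add: field_simps)
      finally show "real (card {r0..r1}) * h \<le> 2 * (B - A)" .
    qed (use \<open>0 < K\<close> in auto)
    finally show False using dense by linarith
  qed
  then obtain r where r: "r \<in> {r0..r1}" "h / K < measure lebesgue (?H r)" by blast
  have "A / h < real r + 1" "real r \<le> B / h"
    using r(1) r0 r1 by auto
  with r(2) show thesis
    using \<open>0 < h\<close> \<open>0 < K\<close> by (intro that[of r]) (auto simp: field_simps)
qed

section \<open>The two densities unfolded into measure inequalities\<close>

lemma lower_density_less_oneD:
  assumes "lower_density P z < 1"
  obtains q where "q < 1" "\<And>e. 0 < e \<Longrightarrow> \<exists>\<gamma> \<delta>. 0 < \<gamma> \<and> \<gamma> < e \<and> 0 < \<delta> \<and> \<delta> < e \<and>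
    measure lebesgue ({z - \<gamma>..z + \<delta>} \<inter> P) \<le> q * (\<gamma> + \<delta>)"
proof -
  let ?X = "\<lambda>(\<gamma>, \<delta>). ereal (measure lebesgue ({z - \<gamma>..z + \<delta>} \<inter> P) / (\<gamma> + \<delta>))"
  have "\<not> 1 \<le> Liminf (at_right 0 \<times>\<^sub>F at_right 0) ?X"
    using assms unfolding lower_density_def by (simp add: not_le)
  then obtain y where y: "y < 1" "\<not> eventually (\<lambda>x. y < ?X x) (at_right 0 \<times>\<^sub>F at_right 0)"
    unfolding le_Liminf_iff by blast
  \<comment> \<open>\<open>y\<close> is an extended real, possibly minus infinity, so a real
    \<open>q\<close> is inserted between it and 1.\<close>
  obtain q where q: "y < ereal q" "ereal q < 1"
    using ereal_dense2[OF y(1)] by blast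
  show thesis
  proof (rule that[of q])
    show "q < 1" using q(2) by simp
    fix e :: real
    assume "0 < e"
    show "\<exists>\<gamma> \<delta>. 0 < \<gamma> \<and> \<gamma> < e \<and> 0 < \<delta> \<and> \<delta> < e \<and>
      measure lebesgue ({z - \<gamma>..z + \<delta>} \<inter> P) \<le> q * (\<gamma> + \<delta>)"
    proof (rule ccontr)
      assume neg: "\<not> ?thesis"
      have ev: "eventually (\<lambda>x. x \<in> {0<..<e}) (at_right (0::real))"
        by (rule eventually_at_right_real) fact
      \<comment> \<open>If the claim fails for \<open>e\<close>, the quotient exceeds
        \<open>y\<close> on the whole open square of side \<open>e\<close>, which belongs to the
        product filter.\<close>
      have "y < ?X (\<gamma>, \<delta>)" if "\<gamma> \<in> {0<..<e}" "\<delta> \<in> {0<..<e}" for \<gamma> \<delta>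
      proof -
        have "q * (\<gamma> + \<delta>) < measure lebesgue ({z - \<gamma>..z + \<delta>} \<inter> P)"
          using neg that by (auto simp: not_le)
        then have "q < measure lebesgue ({z - \<gamma>..z + \<delta>} \<inter> P) / (\<gamma> + \<delta>)"
          using that by (simp add: field_simps)
        with q(1) show ?thesis
          by (simp add: less_trans[of y "ereal q"])
      qed
      then have "eventually (\<lambda>x. y < ?X x) (at_right 0 \<times>\<^sub>F at_right 0)"
        unfolding eventually_prod_filter using ev by blast
      with y(2) show False by simp
    qed
  qed
qed

text \<open>An interval with denominator \<open>2 ^ k\<close> has length \<open>1 / 2 ^ k\<close>,
  so an eventual property along the filter holds for all \<open>k\<close> from some \<open>m\<close>
  on.\<close>

lemma lower_dyadic_density_geD:
  assumes "1 \<le> lower_dyadic_density P z" "t < 1"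
  obtains m where "\<And>r k. m \<le> k \<Longrightarrow> z \<in> {real_of_int r / 2 ^ k .. (real_of_int r + 1) / 2 ^ k} \<Longrightarrow>
    t / 2 ^ k < measure lebesgue ({real_of_int r / 2 ^ k .. (real_of_int r + 1) / 2 ^ k} \<inter> P)"
proof -
  have "ereal t < 1" using assms(2) by simp
  then have "eventually (\<lambda>I. ereal t < ereal (measure lebesgue (I \<inter> P) / measure lebesgue I)) (dyadic_filter z)"
    using assms(1) unfolding lower_dyadic_density_def le_Liminf_iff by blast
  then obtain Q where Q: "eventually Q (at_right 0)" "\<And>I. Q (measure lebesgue I) \<Longrightarrow>
      basic_dyadic_interval I \<Longrightarrow> z \<in> I \<Longrightarrow> t < measure lebesgue (I \<inter> P) / measure lebesgue I"
    unfolding dyadic_filter_def eventually_inf_principal eventually_filtercomap by auto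
  obtain \<eta> where "0 < \<eta>" and \<eta>: "\<And>x. 0 < x \<Longrightarrow> x < \<eta> \<Longrightarrow> Q x"
    using Q(1) unfolding eventually_at_right_field by auto
  obtain m where m: "1 / 2 ^ m < \<eta>"
    using real_arch_pow_inv[of \<eta> "1 / 2"] \<open>0 < \<eta>\<close> by (auto simp: power_one_over)
  show thesis
  proof (rule that[of m])
    fix r k
    let ?I = "{real_of_int r / 2 ^ k .. (real_of_int r + 1) / 2 ^ k}"
    assume "m \<le> k" "z \<in> ?I"
    have I: "measure lebesgue ?I = 1 / 2 ^ k"
      by (simp add: divide_right_mono flip: diff_divide_distrib)
    have "1 / 2 ^ k \<le> (1 / 2 ^ m :: real)"
      using \<open>m \<le> k\<close> by (intro divide_left_mono power_increasing) auto
    with m have "Q (measure lebesgue ?I)"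
      unfolding I by (intro \<eta>) auto
    moreover have "basic_dyadic_interval ?I"
      unfolding basic_dyadic_interval_def by blast
    ultimately have "t < measure lebesgue (?I \<inter> P) / measure lebesgue ?I"
      using \<open>z \<in> ?I\<close> Q(2) by blast
    then show "t / 2 ^ k < measure lebesgue (?I \<inter> P)"
      unfolding I by (simp add: field_simps)
  qed
qed

lemma measure_Int_closed:
  fixes a b :: real
  assumes "closed P" "a \<le> b"
  shows "measure lebesgue ({a..b} \<inter> P) = b - a - measure lebesgue ({a..b} \<inter> - P)"
proof -
  have "measure lebesgue ({a..b} - {a..b} \<inter> - P) = measure lebesgue {a..b} - measure lebesgue ({a..b} \<inter> - P)"
    using assms by (intro measurable_measure_Diff sets.Int) auto
  moreover have "{a..b} - {a..b} \<inter> - P = {a..b} \<inter> P" by blast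
  ultimately show ?thesis using assms by simp
qed

lemma porous_atI:
  assumes "0 < \<epsilon>" "\<And>e. 0 < e \<Longrightarrow> \<exists>\<beta> a. 0 < \<beta> \<and> \<beta> < e \<and>
    {a<..<a + \<epsilon> * \<beta>} \<subseteq> {z - \<beta><..<z + \<beta>} \<and> {a<..<a + \<epsilon> * \<beta>} \<inter> C = {}"
  shows "porous_at C z"
  unfolding porous_at_def frequently_def eventually_at_right_field
  using assms by (metis greaterThan_iff)

section \<open>Porosity at \<open>z\<close> of the class avoiding the dense dyadic intervals\<close>

theorem theorem10p6:
  fixes z :: real and P :: "real set"
  assumes "z \<in> {0..1}"
    and "\<not> porosity_point z"
    and "P \<subseteq> {0..1}"
    and "Pi01_class P"
    and "z \<in> P"
    and "lower_density P z < 1"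
  shows "lower_dyadic_density P z < 1"
proof (rule ccontr)
  assume "\<not> ?thesis"
  then have dyadic: "1 \<le> lower_dyadic_density P z" by simp
  have U: "effectively_open (- P)"
    using assms(4) by (simp add: Pi01_class_def)
  then have "closed P"
    by (simp add: closed_def open_effectively_open)
  \<comment> \<open>The grid covers only the nonnegative half-line, so room to the left of
    \<open>z\<close> is required. At 0 the class \<open>P\<close> itself is porous, as it has no
    negative points.\<close>
  have "z \<noteq> 0"
  proof
    assume "z = 0"
    have "porous_at P z"
    proof (rule porous_atI[of 1])
      fix e :: real
      assume "0 < e"
      then have "{- (e / 2)<..<- (e / 2) + 1 * (e / 2)} \<subseteq> {z - e / 2<..<z + e / 2}"
        "{- (e / 2)<..<- (e / 2) + 1 * (e / 2)} \<inter> P = {}"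
        using assms(3) \<open>z = 0\<close> by auto
      then show "\<exists>\<beta> a. 0 < \<beta> \<and> \<beta> < e \<and> {a<..<a + 1 * \<beta>} \<subseteq> {z - \<beta><..<z + \<beta>} \<and> {a<..<a + 1 * \<beta>} \<inter> P = {}"
        using \<open>0 < e\<close> by (intro exI[of _ "e / 2"] exI[of _ "- (e / 2)"]) auto
    qed simp
    with assms show False
      by (auto simp: porosity_point_def)
  qed
  with assms(1) have "0 < z" by simp
  obtain q where q: "q < 1" and sparse: "\<And>e. 0 < e \<Longrightarrow> \<exists>\<gamma> \<delta>. 0 < \<gamma> \<and> \<gamma> < e \<and> 0 < \<delta> \<and> \<delta> < e \<and>
      measure lebesgue ({z - \<gamma>..z + \<delta>} \<inter> P) \<le> q * (\<gamma> + \<delta>)"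
    using lower_density_less_oneD[OF assms(6)] by blast
  \<comment> \<open>The 2 pays for the doubled density in \<open>exists_dense_cell\<close>: this
    choice gives \<open>2 * L / K < (1 - q) * L\<close>.\<close>
  obtain K :: nat where K: "2 / (1 - q) < real K"
    using reals_Archimedean2 by blast
  have K_pos: "0 < real K"
    using K q by (meson divide_pos_pos diff_gt_0_iff_gt less_trans zero_less_numeral)
  \<comment> \<open>From generation \<open>m\<close> on, the complement of \<open>P\<close> has
    relative measure below \<open>1 / K\<close> in every dyadic interval containing
    \<open>z\<close>; hence none of the intervals removed below contains \<open>z\<close>.\<close>
  obtain m where m: "\<And>r k. m \<le> k \<Longrightarrow> z \<in> {real_of_int r / 2 ^ k .. (real_of_int r + 1) / 2 ^ k} \<Longrightarrow>
      (1 - 1 / real K) / 2 ^ k < measure lebesgue ({real_of_int r / 2 ^ k .. (real_of_int r + 1) / 2 ^ k} \<inter> P)"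
    using lower_dyadic_density_geD[OF dyadic, of "1 - 1 / real K"] K_pos by auto
  define D where "D = {(r, n). 1 / 2 ^ (m + n) < real K *
    measure lebesgue ({real r / 2 ^ (m + n) ..< (real r + 1) / 2 ^ (m + n)} \<inter> - P)}"
  define C where "C = - (\<Union>(r, n)\<in>D. {real r / 2 ^ (m + n) <..< (real r + 1) / 2 ^ (m + n)})"
  have "Pi01_class C"
    using effectively_open_dense_cells[OF U] unfolding Pi01_class_def C_def D_def by simp
  moreover have "z \<in> C"
  proof (rule ccontr)
    assume "z \<notin> C"
    then obtain r n where "(r, n) \<in> D" and z: "z \<in> {real r / 2 ^ (m + n) <..< (real r + 1) / 2 ^ (m + n)}"
      by (auto simp: C_def)
    define a b :: real where "a = real r / 2 ^ (m + n)" and "b = (real r + 1) / 2 ^ (m + n)"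
    have ab: "a \<le> b" "b - a = 1 / 2 ^ (m + n)"
      unfolding a_def b_def by (simp_all add: divide_right_mono flip: diff_divide_distrib)
    have "1 / 2 ^ (m + n) < real K * measure lebesgue ({a..<b} \<inter> - P)"
      using \<open>(r, n) \<in> D\<close> by (simp add: D_def a_def b_def)
    also have "\<dots> \<le> real K * measure lebesgue ({a..b} \<inter> - P)"
      using \<open>closed P\<close>
      by (intro mult_left_mono measure_mono_fmeasurable fmeasurable_Int_fmeasurable sets.Int) auto
    finally have "1 / real K / 2 ^ (m + n) < measure lebesgue ({a..b} \<inter> - P)"
      using K_pos by (simp add: field_simps)
    moreover have "(1 - 1 / real K) / 2 ^ (m + n) < measure lebesgue ({a..b} \<inter> P)"
      using m[of "m + n" "int r"] z by (simp add: a_def b_def)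
    ultimately show False
      unfolding measure_Int_closed[OF \<open>closed P\<close> ab(1)] ab(2) by (simp add: diff_divide_distrib)
  qed
  \<comment> \<open>The radius is \<open>2 * L\<close>, where \<open>L\<close> is the length of a
    sparse interval around \<open>z\<close>. The removed dyadic interval is longer than
    \<open>L / 4\<close>, which is 1/8 of that radius.\<close>
  moreover have "porous_at C z"
  proof (rule porous_atI[of "1 / 8"])
    fix e :: real
    assume "0 < e"
    \<comment> \<open>The three bounds ensure \<open>2 * L < e\<close>, keep
      \<open>z - \<gamma>\<close> positive, and make \<open>L / 2\<close> short enough for
      generations from \<open>m\<close> on.\<close>
    define e' where "e' = min (min (e / 4) z) (1 / 2 ^ m)"
    have "0 < e'" using \<open>0 < e\<close> \<open>0 < z\<close> by (simp add: e'_def)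
    then obtain \<gamma> \<delta> where gd: "0 < \<gamma>" "\<gamma> < e'" "0 < \<delta>" "\<delta> < e'"
      and le: "measure lebesgue ({z - \<gamma>..z + \<delta>} \<inter> P) \<le> q * (\<gamma> + \<delta>)"
      using sparse by blast
    define L where "L = \<gamma> + \<delta>"
    have L: "0 < L" "L / 2 < 1 / 2 ^ m" "2 * L < e" "\<gamma> < z"
      using gd by (auto simp: L_def e'_def)
    \<comment> \<open>Scaling to \<open>L / 2\<close> rather than \<open>L\<close> meets the
      requirement of \<open>exists_dense_cell\<close> that a cell have at most half the length of
      the interval.\<close>
    obtain n where n: "L / 2 / 2 < 1 / 2 ^ (m + n)" "1 / 2 ^ (m + n) \<le> L / 2"
      using exists_dyadic_scale[of "L / 2" m] L by auto
    define h :: real where "h = 1 / 2 ^ (m + n)"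
    have "(1 - q) * L \<le> measure lebesgue ({z - \<gamma>..z + \<delta>} \<inter> - P)"
      using le measure_Int_closed[OF \<open>closed P\<close>, of "z - \<gamma>" "z + \<delta>"] gd
      by (simp add: L_def algebra_simps)
    moreover have "2 < (1 - q) * real K"
      using K q by (simp add: field_simps)
    then have "2 * L / real K < (1 - q) * L"
      using K_pos L(1) mult_strict_right_mono[of 2 "(1 - q) * real K" L]
      by (simp add: pos_divide_less_eq mult_ac)
    ultimately have "2 * (z + \<delta> - (z - \<gamma>)) / real K < measure lebesgue ({z - \<gamma>..z + \<delta>} \<inter> - P)"
      by (simp add: L_def add.commute)
    then obtain r :: nat where "h < real K * measure lebesgue ({real r * h ..< (real r + 1) * h} \<inter> - P)"
      and r: "z - \<gamma> - h < real r * h" "real r * h \<le> z + \<delta>"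
      using \<open>closed P\<close> K_pos gd L n
      by (elim exists_dense_cell[rotated -1]) (auto simp: h_def L_def)
    then have "(r, n) \<in> D"
      by (simp add: D_def h_def)
    then have "{real r * h<..<(real r + 1) * h} \<inter> C = {}"
      by (force simp: C_def h_def)
    moreover have "real r * h + 1 / 8 * (2 * L) \<le> (real r + 1) * h"
      using n(1) unfolding h_def[symmetric] distrib_right by simp
    ultimately have "{real r * h<..<real r * h + 1 / 8 * (2 * L)} \<inter> C = {}"
      by fastforce
    moreover have "2 * h \<le> \<gamma> + \<delta>"
      using n(2) by (simp add: h_def L_def)
    \<comment> \<open>The cell may start before \<open>z - \<gamma>\<close>, but by less than
      \<open>h \<le> L / 2\<close>, so radius \<open>2 * L\<close> leaves enough room on both
      sides.\<close>
    then have "z - 2 * L \<le> real r * h" "real r * h + 1 / 8 * (2 * L) \<le> z + 2 * L"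
      using r gd(1,3) unfolding L_def by (simp_all add: field_simps)
    then have "{real r * h<..<real r * h + 1 / 8 * (2 * L)} \<subseteq> {z - 2 * L<..<z + 2 * L}"
      by auto
    ultimately show "\<exists>\<beta> a. 0 < \<beta> \<and> \<beta> < e \<and> {a<..<a + 1 / 8 * \<beta>} \<subseteq> {z - \<beta><..<z + \<beta>} \<and>
        {a<..<a + 1 / 8 * \<beta>} \<inter> C = {}"
      using L by (intro exI[of _ "2 * L"] exI[of _ "real r * h"]) auto
  qed simp
  ultimately show False
    using assms(2) by (auto simp: porosity_point_def)
qed

end
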